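(* For all $\mathbf{u}=(u,\eta)$ and $\mathbf{v}=(v,w)$ in $H(\mathrm{div})\times L^2$, the bilinear form $a$ satisfies $$a(\mathbf{u},\mathbf{v})\le K\,|||\mathbf{u}|||\,|||\mathbf{v}|||,\qquad K=\max\left\{2,\,1+\frac{k}{\epsilon}\right\}.$$
   Context: Let $\Omega$ be an oriented two-dimensional (Riemannian) surface, for instance an open subset of $\mathbb{R}^2$. Write $(\cdot,\cdot)$ and $\|\cdot\|$ for the $L^2(\Omega)$ inner product and norm of (real) scalar functions or tangent vector fields. $L^2=L^2(\Omega)$, and $H(\mathrm{div})$ is the space of square-integrable tangent vector fields $u$ on $\Omega$ with weak divergence $\nabla\cdot u\in L^2$. For a vector field $u=(u_1,u_2)$, $u^\perp=(-u_2,u_1)$ is its pointwise rotation by $\pi/2$. Parameters: real constants $k>0$ (half the time step), $\epsilon>0$ (Rossby number), $\beta>0$ (Burger number). Coefficients: real measurable functions on $\Omega$: $H$ with $H(x)\ge H_*$ for a constant $H_*>0$ (depth); $f$ with $|f(x)|\le 1$ (Coriolis parameter); $C$ with $0\le C(x)\le C^*$ for a finite constant $C^*$ (damping). Bilinear form: for $\mathbf{u}=(u,\eta)$, $\mathbf{v}=(v,w)$ in $H(\mathrm{div})\times L^2$, $$a(\mathbf{u},\mathbf{v})=\left(\tfrac{1}{H}u,v\right)+\left(\tfrac{fk}{\epsilon H}u^\perp,v\right)-\tfrac{\beta k}{\epsilon^2}(\eta,\nabla\cdot v)+\left(\tfrac{Ck}{H}u,v\right)+\tfrac{\beta}{\epsilon^2}(\eta,w)+\tfrac{\beta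 k}{\epsilon^2}(\nabla\cdot u,w).$$ Weighted norm: $$|||\mathbf{u}|||^2=\left(\tfrac{1+Ck}{H}u,u\right)+\tfrac{k^2\beta}{\epsilon^2}\|\nabla\cdot u\|^2+\tfrac{\beta}{\epsilon^2}\|\eta\|^2 .$$ *)

theory Defs
  imports "HOL-Analysis.Analysis"
begin

section \<open>Oriented Riemannian surfaces\<close>

text \<open>\<open>Ck_on k S f\<close>: f is k times continuously differentiable on the open set S.\<close>

primrec Ck_on :: "nat \<Rightarrow> 'a::euclidean_space set \<Rightarrow> ('a \<Rightarrow> 'b::real_normed_vector) \<Rightarrow> bool" where
  "Ck_on 0 S f \<longleftrightarrow> continuous_on S f"
| "Ck_on (Suc k) S f \<longleftrightarrow>
     (\<exists>D. (\<forall>x\<in>S. (f has_derivative D x) (at x)) \<and> (\<forall>v. Ck_on k S (\<lambda>x. D x v)))"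

definition smooth_on :: "'a::euclidean_space set \<Rightarrow> ('a \<Rightarrow> 'b::real_normed_vector) \<Rightarrow> bool" where
  "smooth_on S f \<longleftrightarrow> (\<forall>k. Ck_on k S f)"

type_synonym 'a chart = "'a set \<times> ('a \<Rightarrow> real^2)"

text \<open>The metric tensor and vector fields are given in classical coordinate form, as families of
  component functions indexed by the charts of the atlas and subject to the usual transformation
  laws. Values outside the domain of the chart are irrelevant.\<close>

record 'a surface =
  surf_top :: "'a topology"
  atlas :: "'a chart set"
  riem_metric :: "'a chart \<Rightarrow> 'a \<Rightarrow> real^2^2"
  area :: "'a measure"

type_synonym 'a vfield = "'a chart \<Rightarrow> 'a \<Rightarrow> real^2"

definition chart_inv :: "'a chart \<Rightarrow> real^2 \<Rightarrow> 'a" where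
  "chart_inv c = inv_into (fst c) (snd c)"

definition transition :: "'a chart \<Rightarrow> 'a chart \<Rightarrow> real^2 \<Rightarrow> real^2" where
  "transition c c' = snd c' \<circ> chart_inv c"

definition transition_deriv :: "'a chart \<Rightarrow> 'a chart \<Rightarrow> 'a \<Rightarrow> real^2 \<Rightarrow> real^2" where
  "transition_deriv c c' p = frechet_derivative (transition c c') (at (snd c p))"

definition oriented_atlas :: "'a topology \<Rightarrow> 'a chart set \<Rightarrow> bool" where
  "oriented_atlas X A \<longleftrightarrow>
     (\<Union>c\<in>A. fst c) = topspace X \<and>
     (\<forall>c\<in>A. openin X (fst c) \<and> open (snd c ` fst c) \<and>
        homeomorphic_map (subtopology X (fst c)) (top_of_set (snd c ` fst c)) (snd c)) \<and>
     (\<forall>c\<in>A. \<forall>c'\<in>A. smooth_on (snd c ` (fst c \<inter> fst c')) (transition c c') \<and>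
        (\<forall>p\<in>fst c \<inter> fst c'. det (matrix (transition_deriv c c' p)) > 0))"

definition metric_tensor :: "'a chart set \<Rightarrow> ('a chart \<Rightarrow> 'a \<Rightarrow> real^2^2) \<Rightarrow> bool" where
  "metric_tensor A g \<longleftrightarrow>
     (\<forall>c\<in>A. smooth_on (snd c ` fst c) (g c \<circ> chart_inv c) \<and>
        (\<forall>p\<in>fst c. transpose (g c p) = g c p \<and> (\<forall>v. v \<noteq> 0 \<longrightarrow> v \<bullet> (g c p *v v) > 0))) \<and>
     (\<forall>c\<in>A. \<forall>c'\<in>A. \<forall>p\<in>fst c \<inter> fst c'. \<forall>v w.
        v \<bullet> (g c p *v w) =
        transition_deriv c c' p v \<bullet> (g c' p *v transition_deriv c c' p w))"

text \<open>The Riemannian area is the unique Borel measure that is \<open>sqrt (det g) dx\<close> in each chart.\<close>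

definition area_measure ::
  "'a topology \<Rightarrow> 'a chart set \<Rightarrow> ('a chart \<Rightarrow> 'a \<Rightarrow> real^2^2) \<Rightarrow> 'a measure \<Rightarrow> bool" where
  "area_measure X A g M \<longleftrightarrow>
     space M = topspace X \<and>
     sets M = sigma_sets (topspace X) {U. openin X U} \<and>
     (\<forall>c\<in>A. \<forall>B\<in>sets M. B \<subseteq> fst c \<longrightarrow>
        emeasure M B =
        (\<integral>\<^sup>+ x \<in> snd c ` B. ennreal (sqrt (det (g c (chart_inv c x)))) \<partial>lborel))"

definition riemannian_surface :: "'a surface \<Rightarrow> bool" where
  "riemannian_surface S \<longleftrightarrow>
     Hausdorff_space (surf_top S) \<and> second_countable (surf_top S) \<and>
     oriented_atlas (surf_top S) (atlas S) \<and>
     metric_tensor (atlas S) (riem_metric S) \<and>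
     area_measure (surf_top S) (atlas S) (riem_metric S) (area S)"

text \<open>Measurability is understood in the sense of Lebesgue, hence the completion.\<close>

abbreviation vol :: "'a surface \<Rightarrow> 'a measure" where
  "vol S \<equiv> completion (area S)"


section \<open>Functions and vector fields\<close>

definition is_vfield :: "'a surface \<Rightarrow> 'a vfield \<Rightarrow> bool" where
  "is_vfield S u \<longleftrightarrow>
     (\<forall>c\<in>atlas S. \<forall>c'\<in>atlas S. \<forall>p\<in>fst c \<inter> fst c'. u c' p = transition_deriv c c' p (u c p))"

definition measurable_vfield :: "'a surface \<Rightarrow> 'a vfield \<Rightarrow> bool" where
  "measurable_vfield S u \<longleftrightarrow>
     is_vfield S u \<and> (\<forall>c\<in>atlas S. u c \<in> borel_measurable (restrict_space (vol S) (fst c)))"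

definition chart_at :: "'a surface \<Rightarrow> 'a \<Rightarrow> 'a chart" where
  "chart_at S p = (SOME c. c \<in> atlas S \<and> p \<in> fst c)"

text \<open>Pointwise metric product of two vector fields, and the differential of a function applied to
  a vector field. Neither depends on the chart in which it is computed.\<close>

definition tinner :: "'a surface \<Rightarrow> 'a vfield \<Rightarrow> 'a vfield \<Rightarrow> 'a \<Rightarrow> real" where
  "tinner S u v p = (let c = chart_at S p in u c p \<bullet> (riem_metric S c p *v v c p))"

definition dapply :: "'a surface \<Rightarrow> ('a \<Rightarrow> real) \<Rightarrow> 'a vfield \<Rightarrow> 'a \<Rightarrow> real" where
  "dapply S \<psi> u p =
     (let c = chart_at S p in frechet_derivative (\<psi> \<circ> chart_inv c) (at (snd c p)) (u c p))"

definition vscale :: "('a \<Rightarrow> real) \<Rightarrow> 'a vfield \<Rightarrow> 'a vfield" where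
  "vscale h u = (\<lambda>c p. h p *\<^sub>R u c p)"

text \<open>Rotation by a positive right angle, written in arbitrary oriented coordinates: with
  \<open>(a, b) = g u\<close> it is \<open>(-b, a) / sqrt (det g)\<close>, which is \<open>(-u2, u1)\<close> in an oriented orthonormal
  frame; see the lemmas \<open>perp_rotation\<close> and \<open>perp_plane\<close> below.\<close>

definition perp :: "'a surface \<Rightarrow> 'a vfield \<Rightarrow> 'a vfield" where
  "perp S u = (\<lambda>c p. let G = riem_metric S c p; w = G *v u c p in
     (1 / sqrt (det G)) *\<^sub>R vector [- (w $ 2), w $ 1])"

text \<open>Elements of the \<open>L2\<close> spaces are represented by functions, not by classes modulo null sets.\<close>

definition L2 :: "'a surface \<Rightarrow> ('a \<Rightarrow> real) set" where
  "L2 S = {h. h \<in> borel_measurable (vol S) \<and> integrable (vol S) (\<lambda>p. (h p)\<^sup>2)}"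

definition L2_vec :: "'a surface \<Rightarrow> 'a vfield set" where
  "L2_vec S = {u. measurable_vfield S u \<and> integrable (vol S) (tinner S u u)}"

definition L2_inner :: "'a surface \<Rightarrow> ('a \<Rightarrow> real) \<Rightarrow> ('a \<Rightarrow> real) \<Rightarrow> real" where
  "L2_inner S h h' = (\<integral>p. h p * h' p \<partial>vol S)"

definition L2_norm :: "'a surface \<Rightarrow> ('a \<Rightarrow> real) \<Rightarrow> real" where
  "L2_norm S h = sqrt (L2_inner S h h)"

definition L2_vec_inner :: "'a surface \<Rightarrow> 'a vfield \<Rightarrow> 'a vfield \<Rightarrow> real" where
  "L2_vec_inner S u v = (\<integral>p. tinner S u v p \<partial>vol S)"

definition test_functions :: "'a surface \<Rightarrow> ('a \<Rightarrow> real) set" where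
  "test_functions S = {\<psi>.
     (\<forall>c\<in>atlas S. smooth_on (snd c ` fst c) (\<psi> \<circ> chart_inv c)) \<and>
     (\<exists>K. compactin (surf_top S) K \<and> (\<forall>p\<in>topspace (surf_top S) - K. \<psi> p = 0))}"

definition weak_div :: "'a surface \<Rightarrow> 'a vfield \<Rightarrow> ('a \<Rightarrow> real) \<Rightarrow> bool" where
  "weak_div S u d \<longleftrightarrow>
     (\<forall>\<psi>\<in>test_functions S.
        (\<integral>p. dapply S \<psi> u p \<partial>vol S) = - (\<integral>p. d p * \<psi> p \<partial>vol S))"

definition Hdiv :: "'a surface \<Rightarrow> 'a vfield set" where
  "Hdiv S = {u \<in> L2_vec S. \<exists>d\<in>L2 S. weak_div S u d}"

text \<open>The weak divergence is unique up to null sets; a representative is chosen.\<close>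

definition divg :: "'a surface \<Rightarrow> 'a vfield \<Rightarrow> 'a \<Rightarrow> real" where
  "divg S u = (SOME d. d \<in> L2 S \<and> weak_div S u d)"


section \<open>The bilinear form and the weighted norm\<close>

definition a_form ::
  "'a surface \<Rightarrow> real \<Rightarrow> real \<Rightarrow> real \<Rightarrow> ('a \<Rightarrow> real) \<Rightarrow> ('a \<Rightarrow> real) \<Rightarrow> ('a \<Rightarrow> real) \<Rightarrow>
   'a vfield \<times> ('a \<Rightarrow> real) \<Rightarrow> 'a vfield \<times> ('a \<Rightarrow> real) \<Rightarrow> real" where
  "a_form S k \<epsilon> \<beta> H f C = (\<lambda>(u, \<eta>) (v, w).
       L2_vec_inner S (vscale (\<lambda>p. 1 / H p) u) v
     + L2_vec_inner S (vscale (\<lambda>p. f p * k / (\<epsilon> * H p)) (perp S u)) v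
     - \<beta> * k / \<epsilon>\<^sup>2 * L2_inner S \<eta> (divg S v)
     + L2_vec_inner S (vscale (\<lambda>p. C p * k / H p) u) v
     + \<beta> / \<epsilon>\<^sup>2 * L2_inner S \<eta> w
     + \<beta> * k / \<epsilon>\<^sup>2 * L2_inner S (divg S u) w)"

definition triple_norm ::
  "'a surface \<Rightarrow> real \<Rightarrow> real \<Rightarrow> real \<Rightarrow> ('a \<Rightarrow> real) \<Rightarrow> ('a \<Rightarrow> real) \<Rightarrow>
   'a vfield \<times> ('a \<Rightarrow> real) \<Rightarrow> real" where
  "triple_norm S k \<epsilon> \<beta> H C = (\<lambda>(u, \<eta>). sqrt (
       L2_vec_inner S (vscale (\<lambda>p. (1 + C p * k) / H p) u) u
     + k\<^sup>2 * \<beta> / \<epsilon>\<^sup>2 * (L2_norm S (divg S u))\<^sup>2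
     + \<beta> / \<epsilon>\<^sup>2 * (L2_norm S \<eta>)\<^sup>2))"


section \<open>Sanity checks\<close>

lemma perp_rotation:
  assumes S: "riemannian_surface S" and c: "c \<in> atlas S" and p: "p \<in> fst c"
  defines "G \<equiv> riem_metric S c p"
  shows "u c p \<bullet> (G *v perp S u c p) = 0"
    and "perp S u c p \<bullet> (G *v perp S u c p) = u c p \<bullet> (G *v u c p)"
    and "u c p \<noteq> 0 \<Longrightarrow> u c p $ 1 * perp S u c p $ 2 - u c p $ 2 * perp S u c p $ 1 > 0"
proof -
  have M: "metric_tensor (atlas S) (riem_metric S)"
    using S unfolding riemannian_surface_def by blast
  have tr: "transpose G = G" and pos: "\<And>v. v \<noteq> 0 \<Longrightarrow> v \<bullet> (G *v v) > 0"
    using M[unfolded metric_tensor_def] c p unfolding G_def by blast+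
  have sym: "G $ 2 $ 1 = G $ 1 $ 2"
    using arg_cong[OF tr, of "\<lambda>m. m $ 1 $ 2"] by (simp add: transpose_def)
  define x y z where "x = G $ 1 $ 1" and "y = G $ 1 $ 2" and "z = G $ 2 $ 2"
  have q: "v \<bullet> (G *v v) = x * (v$1)\<^sup>2 + 2 * y * v$1 * v$2 + z * (v$2)\<^sup>2" for v :: "real^2"
    by (simp add: inner_vec_def matrix_vector_mult_def sum_2 sym x_def y_def z_def
        power2_eq_square algebra_simps)
  have xpos: "x > 0"
    using pos[of "vector [1, 0]"] unfolding q by (simp add: vec_eq_iff forall_2)
  have "x * (x * z - y\<^sup>2) > 0"
    using pos[of "vector [- y, x]"] xpos unfolding q
    by (simp add: vec_eq_iff forall_2 power2_eq_square algebra_simps)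
  then have D: "x * z - y\<^sup>2 > 0"
    using xpos by (simp add: zero_less_mult_iff)
  have detG: "det G = x * z - y\<^sup>2"
    by (simp add: det_2 x_def y_def z_def sym power2_eq_square)
  define s where "s = sqrt (det G)"
  have s: "s > 0" "s\<^sup>2 = x * z - y\<^sup>2"
    using D by (auto simp: s_def detG)
  define a b where "a = u c p $ 1" and "b = u c p $ 2"
  have P: "perp S u c p $ 1 = - ((y * a + z * b) / s)" "perp S u c p $ 2 = (x * a + y * b) / s"
    by (simp_all add: perp_def Let_def flip: G_def)
       (simp_all add: s_def a_def b_def x_def y_def z_def sym matrix_vector_mult_def sum_2)
  have I: "v \<bullet> (G *v w) = x * v$1 * w$1 + y * (v$1 * w$2 + v$2 * w$1) + z * v$2 * w$2"
    for v w :: "real^2"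
    by (simp add: inner_vec_def matrix_vector_mult_def sum_2 sym x_def y_def z_def algebra_simps)
  show "u c p \<bullet> (G *v perp S u c p) = 0"
    unfolding I P a_def[symmetric] b_def[symmetric] using s(1)
    by (simp add: field_simps)
  have "s\<^sup>2 * (perp S u c p \<bullet> (G *v perp S u c p)) =
      x * (y * a + z * b)\<^sup>2 - 2 * y * (y * a + z * b) * (x * a + y * b) + z * (x * a + y * b)\<^sup>2"
    unfolding I P using s(1) by (simp add: field_simps power2_eq_square)
  also have "\<dots> = s\<^sup>2 * (u c p \<bullet> (G *v u c p))"
    unfolding I s(2) a_def[symmetric] b_def[symmetric]
    by (simp add: power2_eq_square algebra_simps)
  finally show "perp S u c p \<bullet> (G *v perp S u c p) = u c p \<bullet> (G *v u c p)"
    using s(1) by simp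
  assume "u c p \<noteq> 0"
  then have "(u c p \<bullet> (G *v u c p)) / s > 0"
    using pos s(1) by simp
  then show "u c p $ 1 * perp S u c p $ 2 - u c p $ 2 * perp S u c p $ 1 > 0"
    unfolding P I a_def[symmetric] b_def[symmetric]
    by (simp add: algebra_simps add_divide_distrib)
qed

text \<open>Open subsets of the plane with the Euclidean metric are an instance.\<close>

definition plane_surface :: "(real^2) set \<Rightarrow> (real^2) surface" where
  "plane_surface \<Omega> = \<lparr>surf_top = top_of_set \<Omega>, atlas = {(\<Omega>, \<lambda>x. x)},
     riem_metric = (\<lambda>_ _. mat 1), area = restrict_space lborel \<Omega>\<rparr>"

lemma Ck_on_const: "Ck_on k S (\<lambda>_. a)"
proof (induction k arbitrary: a)
  case (Suc k)
  show ?case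
    by (auto intro!: exI[of _ "\<lambda>_ _. 0"] Suc)
qed auto

lemma Ck_on_cong:
  assumes "open S" "\<And>x. x \<in> S \<Longrightarrow> f x = g x" "Ck_on k S f"
  shows "Ck_on k S g"
proof (cases k)
  case 0
  then show ?thesis
    using assms by (auto intro: continuous_on_eq)
next
  case (Suc m)
  then obtain D where D: "\<And>x. x \<in> S \<Longrightarrow> (f has_derivative D x) (at x)"
    and C: "\<And>v. Ck_on m S (\<lambda>x. D x v)"
    using assms(3) by auto
  have "(g has_derivative D x) (at x)" if "x \<in> S" for x
    using has_derivative_transform_within_open[OF D[OF that] assms(1) that assms(2)] by simp
  then show ?thesis
    using Suc C by auto
qed

lemma Ck_on_ident: "Ck_on k S (\<lambda>x. x)"
proof (cases k)
  case (Suc m)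
  show ?thesis
    unfolding Suc Ck_on.simps
    by (rule exI[of _ "\<lambda>_ v. v"]) (auto intro: Ck_on_const)
qed auto

lemma riemannian_surface_plane:
  assumes "open \<Omega>"
  shows "riemannian_surface (plane_surface \<Omega>)"
proof -
  let ?c = "(\<Omega>, \<lambda>x::real^2. x)"
  have inv: "chart_inv ?c x = x" if "x \<in> \<Omega>" for x
    using that by (simp add: chart_inv_def inv_into_f_eq inj_on_def)
  have tr: "(transition ?c ?c has_derivative (\<lambda>v. v)) (at x)" if "x \<in> \<Omega>" for x
    by (rule has_derivative_transform_within_open[OF has_derivative_ident assms that])
       (simp add: transition_def inv)
  have td: "transition_deriv ?c ?c x = (\<lambda>v. v)" if "x \<in> \<Omega>" for x
    using frechet_derivative_at[OF tr[OF that]] by (simp add: transition_deriv_def)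
  have m1: "matrix (\<lambda>v::real^2. v) = mat 1"
    using matrix_id_mat_1 by (simp add: id_def)
  have "smooth_on \<Omega> (transition ?c ?c)"
    unfolding smooth_on_def
    by (auto simp: transition_def inv intro: Ck_on_cong[OF assms _ Ck_on_ident])
  then have atl: "oriented_atlas (top_of_set \<Omega>) {?c}"
    unfolding oriented_atlas_def
    using assms by (simp add: td m1 homeomorphic_map_id[unfolded id_def] subtopology_subtopology)
  have met: "metric_tensor {?c} (\<lambda>_ _. mat 1)"
    unfolding metric_tensor_def
    by (auto simp: td smooth_on_def o_def Ck_on_const transpose_mat)
  have "second_countable (euclidean :: (real^2) topology)"
  proof -
    obtain B :: "(real^2) set set" where "countable B" "topological_basis B"
      using ex_countable_basis by blast
    then show ?thesis
      unfolding second_countable_def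
      by (metis open_openin topological_basis_open topological_basisE)
  qed
  then have sc: "second_countable (top_of_set \<Omega>)"
    by (rule second_countable_subtopology)
  have gen: "sets (restrict_space lborel \<Omega>) = sigma_sets \<Omega> {U. openin (top_of_set \<Omega>) U}"
  proof -
    have "\<Omega> \<in> sigma_sets UNIV {U. open U}"
      using assms by (auto intro: sigma_sets.Basic)
    from sigma_sets_Int[OF this]
    have "sets (restrict_space lborel \<Omega>) = sigma_sets \<Omega> ((\<inter>) \<Omega> ` {U. open U})"
      by (simp add: sets_restrict_space sets_borel borel_def)
    also have "(\<inter>) \<Omega> ` {U. open U} = {U. openin (top_of_set \<Omega>) U}"
      by (auto simp: openin_open)
    finally show ?thesis .
  qed
  have "emeasure (restrict_space lborel \<Omega>) B =
      (\<integral>\<^sup>+ x \<in> B. ennreal (sqrt (det (mat 1 :: real^2^2))) \<partial>lborel)"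
    if "B \<in> sets (restrict_space lborel \<Omega>)" for B
    using that assms by (auto simp: sets_restrict_space emeasure_restrict_space)
  then have ar: "area_measure (top_of_set \<Omega>) {?c} (\<lambda>_ _. mat 1) (restrict_space lborel \<Omega>)"
    unfolding area_measure_def by (simp add: space_restrict_space gen)
  show ?thesis
    unfolding riemannian_surface_def plane_surface_def
    using sc atl met ar by (simp add: Hausdorff_space_subtopology)
qed

lemma tinner_plane:
  assumes "p \<in> \<Omega>"
  shows "tinner (plane_surface \<Omega>) u v p = u (\<Omega>, \<lambda>x. x) p \<bullet> v (\<Omega>, \<lambda>x. x) p"
proof -
  have "(SOME c. c = (\<Omega>, \<lambda>x. x) \<and> p \<in> fst c) = (\<Omega>, \<lambda>x::real^2. x)"
    using assms by (intro some_equality) auto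
  then show ?thesis
    by (simp add: tinner_def chart_at_def plane_surface_def Let_def)
qed

lemma perp_plane: "perp (plane_surface \<Omega>) u c p = vector [- (u c p $ 2), u c p $ 1]"
  by (simp add: perp_def plane_surface_def Let_def)

end

theory Submission
  imports Defs
begin

text \<open>The velocity terms are bounded pointwise by \<open>(1 + k/\<epsilon>) (1 + C k)/H |u| |v|\<close>, since \<open>perp\<close> is a
  pointwise isometry, and then by Cauchy--Schwarz. With \<open>x = (x\<^sub>1, x\<^sub>2, x\<^sub>3)\<close> and \<open>y\<close> the square roots
  of the three summands of the squared weighted norms, the form is thus at most
  \<open>(1 + k/\<epsilon>) x\<^sub>1 y\<^sub>1 + x\<^sub>3 y\<^sub>2 + x\<^sub>3 y\<^sub>3 + x\<^sub>2 y\<^sub>3\<close>. The matrix of the last three summands has norm at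
  most 2 (it is the golden ratio).\<close>

section \<open>Cauchy-Schwarz from quadratic forms, and for integrals\<close>

text \<open>A nonnegative binary quadratic form has nonpositive discriminant. Being stated for bare
  numbers, it yields Cauchy-Schwarz both for integrals and for the metric at a point. Definiteness
  is not assumed, so \<open>c = 0\<close> is a separate case.\<close>

lemma abs_le_sqrt_mult_sqrt_if_quadratic_form_nonneg:
  fixes a b c :: real
  assumes nonneg: "\<And>s t. 0 \<le> s\<^sup>2 * a + 2 * s * t * b + t\<^sup>2 * c"
  shows "\<bar>b\<bar> \<le> sqrt a * sqrt c"
proof -
  have a: "a \<ge> 0" and c: "c \<ge> 0"
    using nonneg[of 1 0] nonneg[of 0 1] by auto
  have "b\<^sup>2 \<le> a * c"
  proof (cases "c = 0")
    case True
    have "b = 0"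
    proof (rule ccontr)
      assume "b \<noteq> 0"
      then show False
        \<comment> \<open>For \<open>c = 0\<close> and \<open>s = 1\<close> the form is
          \<open>a + 2 * t * b\<close>, affine in \<open>t\<close>; this \<open>t\<close> gives it
          the value -1.\<close>
        using nonneg[of 1 "- (a + 1) / (2 * b)"] True a by (simp add: field_simps)
    qed
    then show ?thesis
      using a c by simp
  next
    case False
    have "0 \<le> c * (a * c - b\<^sup>2)"
      \<comment> \<open>At \<open>s = c\<close>, \<open>t = - b\<close> the form equals
        \<open>c * (a * c - b^2)\<close>.\<close>
      using nonneg[of c "- b"] by (simp add: power2_eq_square algebra_simps)
    then show ?thesis
      using False c by (simp add: zero_le_mult_iff)
  qed
  then show ?thesis
    using real_sqrt_le_mono[of "b\<^sup>2" "a * c"] by (simp add: real_sqrt_mult)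
qed

lemma integrable_mult_if_square_integrable:
  fixes f g :: "'a \<Rightarrow> real"
  assumes [measurable]: "f \<in> borel_measurable M" "g \<in> borel_measurable M"
    and "integrable M (\<lambda>x. (f x)\<^sup>2)" "integrable M (\<lambda>x. (g x)\<^sup>2)"
  shows "integrable M (\<lambda>x. f x * g x)"
proof (rule Bochner_Integration.integrable_bound)
  show "integrable M (\<lambda>x. (f x)\<^sup>2 + (g x)\<^sup>2)"
    using assms by simp
  have "\<bar>a * b\<bar> \<le> a\<^sup>2 + b\<^sup>2" for a b :: real
    using sum_squares_bound[of "\<bar>a\<bar>" "\<bar>b\<bar>"] abs_ge_zero[of "a * b"] unfolding abs_mult power2_abs by linarith
  then show "AE x in M. norm (f x * g x) \<le> norm ((f x)\<^sup>2 + (g x)\<^sup>2)"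
    by simp
qed measurable

text \<open>The quadratic form in question is the integral of \<open>(s * f x + t * g x)^2\<close>;
  integrability of the product allows it to be expanded term by term.\<close>

lemma Cauchy_Schwarz_integral:
  fixes f g :: "'a \<Rightarrow> real"
  assumes "f \<in> borel_measurable M" "g \<in> borel_measurable M"
    and "integrable M (\<lambda>x. (f x)\<^sup>2)" "integrable M (\<lambda>x. (g x)\<^sup>2)"
  shows "\<bar>\<integral>x. f x * g x \<partial>M\<bar> \<le> sqrt (\<integral>x. (f x)\<^sup>2 \<partial>M) * sqrt (\<integral>x. (g x)\<^sup>2 \<partial>M)"
proof (rule abs_le_sqrt_mult_sqrt_if_quadratic_form_nonneg)
  fix s t :: real
  have "0 \<le> (\<integral>x. (s * f x + t * g x)\<^sup>2 \<partial>M)"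
    by simp
  also have "\<dots> = (\<integral>x. s\<^sup>2 * (f x)\<^sup>2 + 2 * s * t * (f x * g x) + t\<^sup>2 * (g x)\<^sup>2 \<partial>M)"
    by (simp add: power2_eq_square algebra_simps)
  also have "\<dots> = s\<^sup>2 * (\<integral>x. (f x)\<^sup>2 \<partial>M) + 2 * s * t * (\<integral>x. f x * g x \<partial>M)
      + t\<^sup>2 * (\<integral>x. (g x)\<^sup>2 \<partial>M)"
    using assms integrable_mult_if_square_integrable[OF assms] by simp
  finally show "0 \<le> s\<^sup>2 * (\<integral>x. (f x)\<^sup>2 \<partial>M) + 2 * s * t * (\<integral>x. f x * g x \<partial>M)
      + t\<^sup>2 * (\<integral>x. (g x)\<^sup>2 \<partial>M)" .
qed

lemma abs_L2_inner_le:
  assumes "h \<in> L2 S" "h' \<in> L2 S"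
  shows "\<bar>L2_inner S h h'\<bar> \<le> L2_norm S h * L2_norm S h'"
  using Cauchy_Schwarz_integral[of h "vol S" h'] assms
  by (simp add: L2_def L2_norm_def L2_inner_def power2_eq_square)

text \<open>The Bochner integral of a non-integrable \<open>f\<close> is 0 and thus satisfies the bound as well.\<close>

lemma abs_integral_le_if_abs_le:
  fixes f g :: "'a \<Rightarrow> real"
  assumes "integrable M g" "\<And>x. x \<in> space M \<Longrightarrow> \<bar>f x\<bar> \<le> g x"
  shows "\<bar>\<integral>x. f x \<partial>M\<bar> \<le> (\<integral>x. g x \<partial>M)"
proof (cases "integrable M f")
  case True
  have "\<bar>\<integral>x. f x \<partial>M\<bar> \<le> (\<integral>x. \<bar>f x\<bar> \<partial>M)"
    by (rule integral_abs_bound)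
  also have "\<dots> \<le> (\<integral>x. g x \<partial>M)"
    using True assms by (intro Bochner_Integration.integral_mono) auto
  finally show ?thesis .
next
  case False
  have "0 \<le> (\<integral>x. g x \<partial>M)"
    using assms by (intro Bochner_Integration.integral_nonneg) (meson abs_ge_zero order_trans)
  then show ?thesis
    using False by (simp add: not_integrable_integral_eq)
qed

section \<open>The weak divergence, and the metric product at a point\<close>

lemma divg_in_L2:
  assumes "u \<in> Hdiv S"
  shows "divg S u \<in> L2 S"
proof -
  have "\<exists>d. d \<in> L2 S \<and> weak_div S u d"
    using assms by (auto simp: Hdiv_def)
  from someI_ex[OF this] show ?thesis
    by (simp add: divg_def)
qed

lemma chart_at:
  assumes "riemannian_surface S" "p \<in> topspace (surf_top S)"
  shows "chart_at S p \<in> atlas S" "p \<in> fst (chart_at S p)"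
proof -
  have "\<exists>c. c \<in> atlas S \<and> p \<in> fst c"
    using assms unfolding riemannian_surface_def oriented_atlas_def by blast
  from someI_ex[OF this] show "chart_at S p \<in> atlas S" "p \<in> fst (chart_at S p)"
    by (simp_all add: chart_at_def)
qed

lemma space_area:
  assumes "riemannian_surface S"
  shows "space (area S) = topspace (surf_top S)"
  using assms by (simp add: riemannian_surface_def area_measure_def)

lemma tinner_vscale_left: "tinner S (vscale h u) v p = h p * tinner S u v p"
  by (simp add: tinner_def vscale_def Let_def)

lemma tinner_self_nonneg:
  assumes "riemannian_surface S" "p \<in> topspace (surf_top S)"
  shows "0 \<le> tinner S u u p"
proof -
  have "x \<noteq> 0 \<Longrightarrow> 0 < x \<bullet> (riem_metric S (chart_at S p) p *v x)" for x
    using assms(1) chart_at[OF assms] unfolding riemannian_surface_def metric_tensor_def by blast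
  then have "0 \<le> x \<bullet> (riem_metric S (chart_at S p) p *v x)" for x
    by (cases "x = 0") (simp_all add: less_imp_le)
  then show ?thesis
    by (simp add: tinner_def Let_def)
qed

lemma tinner_perp_self:
  assumes "riemannian_surface S" "p \<in> topspace (surf_top S)"
  shows "tinner S (perp S u) (perp S u) p = tinner S u u p"
  using perp_rotation(2)[OF assms(1) chart_at[OF assms]] by (simp add: tinner_def Let_def)

text \<open>The metric at \<open>p\<close> is symmetric and positive definite, so this is
  Cauchy-Schwarz in the tangent plane, computed in the chart \<open>chart_at S p\<close>.\<close>

lemma abs_tinner_le:
  assumes "riemannian_surface S" "p \<in> topspace (surf_top S)"
  shows "\<bar>tinner S u v p\<bar> \<le> sqrt (tinner S u u p) * sqrt (tinner S v v p)"
proof (rule abs_le_sqrt_mult_sqrt_if_quadratic_form_nonneg)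
  fix s t :: real
  define G where "G = riem_metric S (chart_at S p) p"
  have "transpose G = G"
    using assms(1) chart_at[OF assms]
    unfolding G_def riemannian_surface_def metric_tensor_def by blast
  then have sym: "y \<bullet> (G *v x) = x \<bullet> (G *v y)" for x y
    using dot_lmul_matrix[of x G y] transpose_matrix_vector[of G x]
    by (simp add: inner_commute)
  \<comment> \<open>Nonnegativity holds for any family of components, so no transformation law has
    to be checked for the linear combination.\<close>
  have "0 \<le> tinner S (\<lambda>c p. s *\<^sub>R u c p + t *\<^sub>R v c p) (\<lambda>c p. s *\<^sub>R u c p + t *\<^sub>R v c p) p"
    by (rule tinner_self_nonneg[OF assms])
  also have "\<dots> = s\<^sup>2 * tinner S u u p + 2 * s * t * tinner S u v p + t\<^sup>2 * tinner S v v p"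
    unfolding tinner_def Let_def G_def[symmetric]
    by (simp add: matrix_vector_right_distrib matrix_vector_mult_scaleR inner_add_left
        inner_add_right sym[of "v (chart_at S p) p" "u (chart_at S p) p"] power2_eq_square distrib_left mult_ac)
  finally show "0 \<le> s\<^sup>2 * tinner S u u p + 2 * s * t * tinner S u v p + t\<^sup>2 * tinner S v v p" .
qed

section \<open>Weighted Cauchy-Schwarz for vector fields\<close>

text \<open>The weight is split as \<open>sqrt (m p) * sqrt (m p)\<close>, one factor going to each
  field, which reduces the claim to scalar functions. The bound \<open>B\<close> makes the weighted
  lengths square integrable. The integrand is the product of the lengths, which dominates the metric
  products of both \<open>u\<close> and \<open>perp S u\<close> with \<open>v\<close>.\<close>

lemma weighted_Cauchy_Schwarz_L2_vec:
  assumes S: "riemannian_surface S"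
    and u: "u \<in> L2_vec S" and v: "v \<in> L2_vec S"
    and m [measurable]: "m \<in> borel_measurable (vol S)"
    and bounds: "\<And>p. p \<in> topspace (surf_top S) \<Longrightarrow> 0 \<le> m p \<and> m p \<le> B"
  defines "g \<equiv> \<lambda>p. m p * (sqrt (tinner S u u p) * sqrt (tinner S v v p))"
  shows "integrable (vol S) g"
    and "(\<integral>p. g p \<partial>vol S) \<le>
      sqrt (L2_vec_inner S (vscale m u) u) * sqrt (L2_vec_inner S (vscale m v) v)"
proof -
  define F where "F = (\<lambda>x p. sqrt (m p) * sqrt (tinner S x x p))"
  have sq: "(F x p)\<^sup>2 = m p * tinner S x x p" if "p \<in> space (vol S)" for x p
    using that bounds tinner_self_nonneg[OF S, of p x]
    by (simp add: F_def power_mult_distrib space_area[OF S])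
  have gF: "g p = F u p * F v p" if "p \<in> space (vol S)" for p
    using that bounds[of p] by (simp add: F_def g_def space_area[OF S])
  have F: "F x \<in> borel_measurable (vol S)" "integrable (vol S) (\<lambda>p. (F x p)\<^sup>2)"
    if "x \<in> L2_vec S" for x
  proof -
    have int: "integrable (vol S) (tinner S x x)"
      using that by (simp add: L2_vec_def)
    \<comment> \<open>Measurability of the squared length is read off from its integrability, which
      avoids any argument about how \<open>chart_at\<close> selects charts.\<close>
    then have [measurable]: "tinner S x x \<in> borel_measurable (vol S)"
      by (rule borel_measurable_integrable)
    show [measurable]: "F x \<in> borel_measurable (vol S)"
      unfolding F_def by measurable
    show "integrable (vol S) (\<lambda>p. (F x p)\<^sup>2)"
    proof (rule Bochner_Integration.integrable_bound)
      show "integrable (vol S) (\<lambda>p. B * tinner S x x p)"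
        using int by simp
      have "norm ((F x p)\<^sup>2) \<le> norm (B * tinner S x x p)" if "p \<in> space (vol S)" for p
        using that bounds[of p] tinner_self_nonneg[OF S, of p x] unfolding sq[OF that]
        by (simp add: space_area[OF S] abs_mult mult_right_mono)
      then show "AE p in vol S. norm ((F x p)\<^sup>2) \<le> norm (B * tinner S x x p)"
        by (rule AE_I2)
    qed measurable
  qed
  have "integrable (vol S) (\<lambda>p. F u p * F v p)"
    by (rule integrable_mult_if_square_integrable[OF F(1)[OF u] F(1)[OF v] F(2)[OF u] F(2)[OF v]])
  then show "integrable (vol S) g"
    by (rule Bochner_Integration.integrable_cong[OF refl, THEN iffD1, rotated]) (simp only: gF)
  have norm_F: "(\<integral>p. (F x p)\<^sup>2 \<partial>vol S) = L2_vec_inner S (vscale m x) x" for x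
    unfolding L2_vec_inner_def tinner_vscale_left
    by (rule Bochner_Integration.integral_cong) (simp_all only: sq)
  have "(\<integral>p. g p \<partial>vol S) = (\<integral>p. F u p * F v p \<partial>vol S)"
    by (rule Bochner_Integration.integral_cong) (simp_all only: gF)
  then show "(\<integral>p. g p \<partial>vol S) \<le>
      sqrt (L2_vec_inner S (vscale m u) u) * sqrt (L2_vec_inner S (vscale m v) v)"
    using Cauchy_Schwarz_integral[OF F(1)[OF u] F(1)[OF v] F(2)[OF u] F(2)[OF v]]
    by (simp add: norm_F)
qed

section \<open>The inequality between the components of the norms\<close>

lemma Cauchy_Schwarz3:
  fixes x1 x2 x3 y1 y2 y3 :: real
  shows "x1 * y1 + x2 * y2 + x3 * y3 \<le>
    sqrt (x1\<^sup>2 + x2\<^sup>2 + x3\<^sup>2) * sqrt (y1\<^sup>2 + y2\<^sup>2 + y3\<^sup>2)"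
  using norm_cauchy_schwarz[of "(x1, x2, x3)" "(y1, y2, y3)"]
  by (simp add: norm_prod_def inner_prod_def add.assoc)

text \<open>The second and third components are merged into lengths \<open>X\<close> and
  \<open>Y\<close>. The off-diagonal pair and \<open>x3 * y3\<close> are each at most
  \<open>X * Y\<close>, which is where the 2 comes from. Enlarging the coefficients \<open>L\<close>
  and 2 to their maximum leaves Cauchy-Schwarz for \<open>(x1, X)\<close> and
  \<open>(y1, Y)\<close>.\<close>

lemma block_form_le:
  fixes x1 x2 x3 y1 y2 y3 L :: real
  assumes nonneg: "0 \<le> x1" "0 \<le> x2" "0 \<le> x3" "0 \<le> y1" "0 \<le> y2" "0 \<le> y3"
  shows "L * (x1 * y1) + x3 * y2 + x3 * y3 + x2 * y3 \<le>
    max 2 L * sqrt (x1\<^sup>2 + x2\<^sup>2 + x3\<^sup>2) * sqrt (y1\<^sup>2 + y2\<^sup>2 + y3\<^sup>2)"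
proof -
  define X Y where "X = sqrt (x2\<^sup>2 + x3\<^sup>2)" and "Y = sqrt (y2\<^sup>2 + y3\<^sup>2)"
  have XY: "0 \<le> X" "0 \<le> Y" "X\<^sup>2 = x2\<^sup>2 + x3\<^sup>2" "Y\<^sup>2 = y2\<^sup>2 + y3\<^sup>2"
    by (simp_all add: X_def Y_def)
  \<comment> \<open>Cauchy-Schwarz with the two entries of the first vector swapped, which keeps its
    length.\<close>
  have "x3 * y2 + x2 * y3 \<le> X * Y"
    using Cauchy_Schwarz3[of 0 0 x3 y2 x2 y3] by (simp add: X_def Y_def add.commute)
  moreover have "x3 * y3 \<le> X * Y"
    using nonneg by (intro mult_mono) (simp_all add: X_def Y_def real_le_rsqrt)
  ultimately have "L * (x1 * y1) + x3 * y2 + x3 * y3 + x2 * y3 \<le> L * (x1 * y1) + 2 * (X * Y)"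
    by simp
  also have "\<dots> \<le> max 2 L * (x1 * y1) + max 2 L * (X * Y)"
    using nonneg XY by (intro add_mono mult_right_mono) simp_all
  also have "\<dots> = max 2 L * (x1 * y1 + X * Y)"
    by (simp add: distrib_left)
  also have "\<dots> \<le> max 2 L * (sqrt (x1\<^sup>2 + X\<^sup>2) * sqrt (y1\<^sup>2 + Y\<^sup>2))"
    using Cauchy_Schwarz3[of x1 y1 X Y 0 0] by (intro mult_left_mono) simp_all
  finally show ?thesis
    unfolding XY by (simp add: add.assoc mult.assoc)
qed

section \<open>The mass, Coriolis and damping terms\<close>

text \<open>All three terms are compared with one integral of \<open>m p * N p\<close>: the mass and
  damping weights add up to exactly \<open>m\<close> and contribute 1, the Coriolis weight is at
  most \<open>k / \<epsilon>\<close> times \<open>m\<close>. Cauchy-Schwarz is then applied once,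
  with weight \<open>m\<close>.\<close>

lemma velocity_terms_le:
  assumes S: "riemannian_surface S" and k: "k > 0" and \<epsilon>: "\<epsilon> > 0"
    and [measurable]: "H \<in> borel_measurable (vol S)" "C \<in> borel_measurable (vol S)"
    and Hmin: "Hmin > 0" "\<And>p. p \<in> topspace (surf_top S) \<Longrightarrow> H p \<ge> Hmin"
    and f: "\<And>p. p \<in> topspace (surf_top S) \<Longrightarrow> \<bar>f p\<bar> \<le> 1"
    and C: "\<And>p. p \<in> topspace (surf_top S) \<Longrightarrow> 0 \<le> C p \<and> C p \<le> Cmax"
    and u: "u \<in> L2_vec S" and v: "v \<in> L2_vec S"
  defines "m \<equiv> \<lambda>p. (1 + C p * k) / H p"
  shows "L2_vec_inner S (vscale (\<lambda>p. 1 / H p) u) v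
     + L2_vec_inner S (vscale (\<lambda>p. f p * k / (\<epsilon> * H p)) (perp S u)) v
     + L2_vec_inner S (vscale (\<lambda>p. C p * k / H p) u) v \<le>
     (1 + k / \<epsilon>) * (sqrt (L2_vec_inner S (vscale m u) u) * sqrt (L2_vec_inner S (vscale m v) v))"
proof -
  define N where "N = (\<lambda>p. sqrt (tinner S u u p) * sqrt (tinner S v v p))"
  have sp: "space (vol S) = topspace (surf_top S)"
    by (simp add: space_area[OF S])
  have Hpos: "0 < H p" if "p \<in> topspace (surf_top S)" for p
    using Hmin that by (meson less_le_trans)
  have int: "integrable (vol S) (\<lambda>p. h p * N p)"
    and cs: "(\<integral>p. h p * N p \<partial>vol S) \<le>
      sqrt (L2_vec_inner S (vscale h u) u) * sqrt (L2_vec_inner S (vscale h v) v)"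
    if "h \<in> borel_measurable (vol S)"
      "\<And>p. p \<in> topspace (surf_top S) \<Longrightarrow> 0 \<le> h p \<and> h p \<le> B" for h B
    unfolding N_def
    by (rule weighted_Cauchy_Schwarz_L2_vec(1)[OF S u v that]
        weighted_Cauchy_Schwarz_L2_vec(2)[OF S u v that]; assumption)+
  \<comment> \<open>\<open>Hmin\<close> and \<open>Cmax\<close> enter through these bounds on the
    weights, which give integrability against \<open>N\<close>; the final constant is independent of
    them.\<close>
  have bound1: "0 \<le> 1 / H p \<and> 1 / H p \<le> 1 / Hmin" if "p \<in> topspace (surf_top S)" for p
    using Hmin that Hpos[OF that] by (auto intro!: divide_left_mono)
  have boundC: "0 \<le> C p * k / H p \<and> C p * k / H p \<le> Cmax * k / Hmin"
    if "p \<in> topspace (surf_top S)" for p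
    using Hmin that C[OF that] Hpos[OF that] k
    by (auto intro!: frac_le mult_right_mono mult_nonneg_nonneg)
  have m_eq: "m p = 1 / H p + C p * k / H p" for p
    by (simp add: m_def add_divide_distrib)
  have boundm: "0 \<le> m p \<and> m p \<le> 1 / Hmin + Cmax * k / Hmin"
    if "p \<in> topspace (surf_top S)" for p
    using bound1[OF that] boundC[OF that] unfolding m_eq by linarith
  have int1: "integrable (vol S) (\<lambda>p. 1 / H p * N p)"
    by (rule int[OF _ bound1]) measurable
  have intC: "integrable (vol S) (\<lambda>p. C p * k / H p * N p)"
    by (rule int[OF _ boundC]) measurable
  have m_meas: "m \<in> borel_measurable (vol S)"
    unfolding m_def by measurable
  have intm: "integrable (vol S) (\<lambda>p. m p * N p)"
    by (rule int[OF m_meas boundm])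
  have N: "\<bar>tinner S u v p\<bar> \<le> N p" "\<bar>tinner S (perp S u) v p\<bar> \<le> N p" "0 \<le> N p"
    if "p \<in> topspace (surf_top S)" for p
    using abs_tinner_le[OF S that, of u v] abs_tinner_le[OF S that, of "perp S u" v]
      tinner_self_nonneg[OF S that]
    by (simp_all add: N_def tinner_perp_self[OF S that])
  have t1: "\<bar>L2_vec_inner S (vscale (\<lambda>p. 1 / H p) u) v\<bar> \<le> (\<integral>p. 1 / H p * N p \<partial>vol S)"
    unfolding L2_vec_inner_def tinner_vscale_left
    using int1
  proof (rule abs_integral_le_if_abs_le)
    fix p assume "p \<in> space (vol S)"
    then show "\<bar>1 / H p * tinner S u v p\<bar> \<le> 1 / H p * N p"
      unfolding sp abs_mult using N bound1 by (intro mult_mono) auto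
  qed
  have tC: "\<bar>L2_vec_inner S (vscale (\<lambda>p. C p * k / H p) u) v\<bar> \<le> (\<integral>p. C p * k / H p * N p \<partial>vol S)"
    unfolding L2_vec_inner_def tinner_vscale_left
    using intC
  proof (rule abs_integral_le_if_abs_le)
    fix p assume "p \<in> space (vol S)"
    then have "\<bar>C p * k / H p\<bar> = C p * k / H p" "\<bar>tinner S u v p\<bar> \<le> N p" "0 \<le> C p * k / H p"
      unfolding sp using N boundC by (simp_all only: abs_of_nonneg)
    then show "\<bar>C p * k / H p * tinner S u v p\<bar> \<le> C p * k / H p * N p"
      unfolding abs_mult[of "C p * k / H p"] by (simp only: mult_left_mono)
  qed
  have "\<bar>L2_vec_inner S (vscale (\<lambda>p. f p * k / (\<epsilon> * H p)) (perp S u)) v\<bar> \<le>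
      (\<integral>p. k / \<epsilon> * (m p * N p) \<partial>vol S)"
    unfolding L2_vec_inner_def tinner_vscale_left
  proof (rule abs_integral_le_if_abs_le)
    show "integrable (vol S) (\<lambda>p. k / \<epsilon> * (m p * N p))"
      using intm by (rule integrable_mult_right)
    fix p assume "p \<in> space (vol S)"
    then have p: "p \<in> topspace (surf_top S)"
      by (simp only: sp)
    have "\<bar>f p * k / (\<epsilon> * H p)\<bar> = k / \<epsilon> * (\<bar>f p\<bar> * (1 / H p))"
      using k \<epsilon> Hpos[OF p] by (simp add: abs_mult)
    \<comment> \<open>Nonnegative damping gives \<open>1 / H p \<le> m p\<close>.\<close>
    also have "\<dots> \<le> k / \<epsilon> * (1 * m p)"
      using k \<epsilon> f[OF p] bound1[OF p] boundC[OF p]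
      by (intro mult_left_mono mult_mono) (auto simp: m_eq)
    finally have "\<bar>f p * k / (\<epsilon> * H p)\<bar> * \<bar>tinner S (perp S u) v p\<bar> \<le> k / \<epsilon> * m p * N p"
      using N[OF p] boundm[OF p] k \<epsilon> by (intro mult_mono) auto
    then show "\<bar>f p * k / (\<epsilon> * H p) * tinner S (perp S u) v p\<bar> \<le> k / \<epsilon> * (m p * N p)"
      by (simp add: abs_mult mult.assoc)
  qed
  then have tf: "\<bar>L2_vec_inner S (vscale (\<lambda>p. f p * k / (\<epsilon> * H p)) (perp S u)) v\<bar> \<le>
      k / \<epsilon> * (\<integral>p. m p * N p \<partial>vol S)"
    by simp
  \<comment> \<open>Since the split is exact, mass and damping together cost 1 rather than
    2.\<close>
  have "(\<integral>p. m p * N p \<partial>vol S) =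
      (\<integral>p. 1 / H p * N p \<partial>vol S) + (\<integral>p. C p * k / H p * N p \<partial>vol S)"
    unfolding m_eq distrib_right by (rule Bochner_Integration.integral_add[OF int1 intC])
  then have "L2_vec_inner S (vscale (\<lambda>p. 1 / H p) u) v
     + L2_vec_inner S (vscale (\<lambda>p. f p * k / (\<epsilon> * H p)) (perp S u)) v
     + L2_vec_inner S (vscale (\<lambda>p. C p * k / H p) u) v \<le> (1 + k / \<epsilon>) * (\<integral>p. m p * N p \<partial>vol S)"
    using t1 tC tf unfolding distrib_right by linarith
  also have "(\<integral>p. m p * N p \<partial>vol S) \<le>
      sqrt (L2_vec_inner S (vscale m u) u) * sqrt (L2_vec_inner S (vscale m v) v)"
    by (rule cs[OF m_meas boundm])
  finally show ?thesis
    using k \<epsilon> by (simp add: mult_left_mono)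
qed

section \<open>Reduction of the form to its norm components\<close>

theorem theorem3p1:
  fixes S :: "'a surface"
    and k \<epsilon> \<beta> Hmin Cmax :: real
    and H f C :: "'a \<Rightarrow> real"
    and u v :: "'a vfield" and \<eta> w :: "'a \<Rightarrow> real"
  assumes "riemannian_surface S"
    and "k > 0" and "\<epsilon> > 0" and "\<beta> > 0"
    and "H \<in> borel_measurable (vol S)" and "Hmin > 0"
    and "\<And>p. p \<in> topspace (surf_top S) \<Longrightarrow> H p \<ge> Hmin"
    and "f \<in> borel_measurable (vol S)"
    and "\<And>p. p \<in> topspace (surf_top S) \<Longrightarrow> \<bar>f p\<bar> \<le> 1"
    and "C \<in> borel_measurable (vol S)"
    and "\<And>p. p \<in> topspace (surf_top S) \<Longrightarrow> 0 \<le> C p \<and> C p \<le> Cmax"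
    and "(u, \<eta>) \<in> Hdiv S \<times> L2 S"
    and "(v, w) \<in> Hdiv S \<times> L2 S"
  shows "a_form S k \<epsilon> \<beta> H f C (u, \<eta>) (v, w) \<le>
    max 2 (1 + k / \<epsilon>) * triple_norm S k \<epsilon> \<beta> H C (u, \<eta>) * triple_norm S k \<epsilon> \<beta> H C (v, w)"
proof -
  have u: "u \<in> L2_vec S" "divg S u \<in> L2 S" "\<eta> \<in> L2 S"
    and v: "v \<in> L2_vec S" "divg S v \<in> L2 S" "w \<in> L2 S"
    using assms(12,13) divg_in_L2[of u S] divg_in_L2[of v S] by (auto simp: Hdiv_def)
  define m where "m = (\<lambda>p. (1 + C p * k) / H p)"
  define x1 where "x1 = (\<lambda>y. sqrt (L2_vec_inner S (vscale m y) y))"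
  \<comment> \<open>With \<open>b^2 = \<beta> / \<epsilon>^2\<close>, the components of the norm are
    \<open>x1 y\<close>, \<open>k * b\<close> times the norm of the divergence, and \<open>b\<close>
    times the norm of the scalar part.\<close>
  define b where "b = sqrt \<beta> / \<epsilon>"
  have b: "b \<ge> 0" "b\<^sup>2 = \<beta> / \<epsilon>\<^sup>2"
    using assms(3,4) by (simp_all add: b_def power_divide)
  have norm_nonneg: "0 \<le> L2_norm S h" for h
    by (simp add: L2_norm_def L2_inner_def)
  \<comment> \<open>Without this sign, squaring the root \<open>x1 y\<close> would not recover the
    weighted velocity term of the norm.\<close>
  have weight_nonneg: "0 \<le> L2_vec_inner S (vscale m y) y" for y
    unfolding L2_vec_inner_def tinner_vscale_left
  proof (rule Bochner_Integration.integral_nonneg)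
    fix p assume "p \<in> space (vol S)"
    then have p: "p \<in> topspace (surf_top S)"
      by (simp add: space_area[OF assms(1)])
    have "0 < H p"
      using assms(6) assms(7)[OF p] by linarith
    then show "0 \<le> m p * tinner S y y p"
      using assms(2) assms(11)[OF p] tinner_self_nonneg[OF assms(1) p, of y]
      by (simp add: m_def)
  qed
  have norm_eq: "triple_norm S k \<epsilon> \<beta> H C (y, z) =
      sqrt ((x1 y)\<^sup>2 + (k * b * L2_norm S (divg S y))\<^sup>2 + (b * L2_norm S z)\<^sup>2)" for y z
    using weight_nonneg[of y]
    by (simp add: triple_norm_def x1_def power_mult_distrib b(2) flip: m_def)
  \<comment> \<open>The second form serves the pairing of \<open>\<eta>\<close> with
    \<open>divg S v\<close>, which enters with a minus sign.\<close>
  have cs: "c * L2_inner S h h' \<le> c * (L2_norm S h * L2_norm S h')"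
    "- (c * L2_inner S h h') \<le> c * (L2_norm S h * L2_norm S h')"
    if "h \<in> L2 S" "h' \<in> L2 S" "0 \<le> c" for c h h'
    using mult_left_mono[OF abs_L2_inner_le[OF that(1,2)] that(3)]
      abs_le_iff[of "c * L2_inner S h h'"] that(3)
    by (simp_all add: abs_mult)
  have c_nonneg: "0 \<le> \<beta> * k / \<epsilon>\<^sup>2" "0 \<le> \<beta> / \<epsilon>\<^sup>2"
    using assms(2,4) by simp_all
  have "L2_vec_inner S (vscale (\<lambda>p. 1 / H p) u) v
     + L2_vec_inner S (vscale (\<lambda>p. f p * k / (\<epsilon> * H p)) (perp S u)) v
     + L2_vec_inner S (vscale (\<lambda>p. C p * k / H p) u) v \<le> (1 + k / \<epsilon>) * (x1 u * x1 v)"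
    using velocity_terms_le[OF assms(1,2,3,5,10,6,7,9,11) u(1) v(1)]
    by (simp add: x1_def m_def)
  then have "a_form S k \<epsilon> \<beta> H f C (u, \<eta>) (v, w) \<le> (1 + k / \<epsilon>) * (x1 u * x1 v)
      + \<beta> * k / \<epsilon>\<^sup>2 * (L2_norm S \<eta> * L2_norm S (divg S v))
      + \<beta> / \<epsilon>\<^sup>2 * (L2_norm S \<eta> * L2_norm S w)
      + \<beta> * k / \<epsilon>\<^sup>2 * (L2_norm S (divg S u) * L2_norm S w)"
    using cs(2)[OF u(3) v(2) c_nonneg(1)] cs(1)[OF u(3) v(3) c_nonneg(2)]
      cs(1)[OF u(2) v(3) c_nonneg(1)]
    unfolding a_form_def prod.case by linarith
  \<comment> \<open>Each coefficient is divided between its two norms: a divergence takes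
    \<open>k * b\<close>, a scalar part takes \<open>b\<close>. The result has the shape of
    \<open>block_form_le\<close>.\<close>
  also have "\<dots> = (1 + k / \<epsilon>) * (x1 u * x1 v)
      + b * L2_norm S \<eta> * (k * b * L2_norm S (divg S v))
      + b * L2_norm S \<eta> * (b * L2_norm S w)
      + k * b * L2_norm S (divg S u) * (b * L2_norm S w)"
  proof -
    have b2: "\<beta> / \<epsilon>\<^sup>2 = b * b"
      unfolding b(2)[symmetric] by (rule power2_eq_square)
    then have "\<beta> * k / \<epsilon>\<^sup>2 = k * b * b"
      by (metis mult.assoc mult.commute times_divide_eq_left)
    then show ?thesis
      by (simp only: b2 mult_ac)
  qed
  also have "\<dots> \<le> max 2 (1 + k / \<epsilon>) * triple_norm S k \<epsilon> \<beta> H C (u, \<eta>)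
      * triple_norm S k \<epsilon> \<beta> H C (v, w)"
    unfolding norm_eq
    using assms(2) b(1) norm_nonneg weight_nonneg
    by (intro block_form_le) (simp_all add: x1_def)
  finally show ?thesis .
qed

end
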